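(* Let $n \ge 0$. For every non-zero $a$ in $A_n$, the $\mathbb{R}$-linear map $M_a$ is diagonalizable (over $\mathbb{R}$) with non-negative eigenvalues. If $\lambda_1$ and $\lambda_2$ are distinct eigenvalues of $a$, then $\operatorname{Eig}_{\lambda_1}(a)$ and $\operatorname{Eig}_{\lambda_2}(a)$ are orthogonal.
   Context: The Cayley-Dickson algebras $A_n$ are the (generally non-associative) unital $\mathbb{R}$-algebras with conjugation defined inductively: $A_0=\mathbb{R}$ with trivial conjugation; $A_n=A_{n-1}\times A_{n-1}$ additively, with $(a,b)^*=(a^*,-b)$ and $(a,b)(c,d)=(ac-d^*b,\ da+bc^* )$. One views $A_{n-1}$ as the subalgebra $A_{n-1}\times 0$ of $A_n$. $\operatorname{Re}(x)=\frac12(x+x^* )$ (a real number). $A_n$ is a positive-definite real inner product space via $\langle a,b\rangle_{\mathbb{R}}=\operatorname{Re}(ab^* )$; orthogonality refers to this inner product, and $|a|=\sqrt{aa^*}=\sqrt{\langle a,a\rangle_{\mathbb{R}}}$. For non-zero $a\in A_n$, $L_a$ is left multiplication by $a$ and $M_a=\frac{1}{|a|^2}L_{a^*}L_a$, i.e. $M_a(x)=\frac{1}{|a|^2}a^*(ax)$. The eigenvalues of $a$ are the eigenvalues of $M_a$, and $\operatorname{Eig}_\lambda(a)=\{x\in A_n : M_a(x)=\lambda x\}$. *)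

theory Defs
  imports "HOL-Analysis.Analysis" "HOL-Analysis.Finite_Function_Topology"
begin

text \<open>
  Since the \<open>n\<close>-th Cayley-Dickson algebra is to be quantified over \<open>n\<close>, its elements are
  represented by finitely supported coordinate vectors: \<open>A\<^sub>n\<close> consists of the vectors
  supported in \<open>{..<2^n}\<close>, and a pair \<open>(a, b)\<close> in \<open>A\<^sub>n \<times> A\<^sub>n\<close> is \<open>a\<close> followed by \<open>b\<close>
  shifted by \<open>2^n\<close>. Then \<open>(a, 0) = a\<close>, so \<open>A\<^sub>n\<close> is literally a subset of
  \<open>A\<^sub>n\<^sub>+\<^sub>1\<close>, and \<open>A\<^sub>0\<close>, the multiples of \<open>Poly_Mapping.single 0 1\<close>, is the
  copy of \<open>\<real>\<close> inside every \<open>A\<^sub>n\<close>.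

  Only the real vector space structure of \<open>nat \<Rightarrow>\<^sub>0 real\<close> is used below. Its library
  multiplication (convolution) and norm (an \<open>l\<^sup>1\<close> norm) are unrelated to those of \<open>A\<^sub>n\<close>.
\<close>

type_synonym cd_vec = "nat \<Rightarrow>\<^sub>0 real"

definition cd_alg :: "nat \<Rightarrow> cd_vec set" where
  "cd_alg n = {x. Poly_Mapping.keys x \<subseteq> {..<2 ^ n}}"

definition cd_of_real :: "real \<Rightarrow> cd_vec" where
  "cd_of_real r = Poly_Mapping.single 0 r"

lift_definition cd_pair :: "nat \<Rightarrow> cd_vec \<Rightarrow> cd_vec \<Rightarrow> cd_vec" is
  "\<lambda>n f g i. if i < 2 ^ n then f i else g (i - 2 ^ n)"
proof -
  fix n and f g :: "nat \<Rightarrow> real"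
  assume "finite {x. f x \<noteq> 0}" and g: "finite {x. g x \<noteq> 0}"
  have "{i. (if i < 2 ^ n then f i else g (i - 2 ^ n)) \<noteq> 0}
      \<subseteq> {..<2 ^ n} \<union> (\<lambda>i. i + 2 ^ n) ` {x. g x \<noteq> 0}"
    by (auto simp: image_iff not_less split: if_splits) (metis le_add_diff_inverse2 not_less)+
  then show "finite {i. (if i < 2 ^ n then f i else g (i - 2 ^ n)) \<noteq> 0}"
    by (rule finite_subset) (use g in simp)
qed

lift_definition cd_fst :: "nat \<Rightarrow> cd_vec \<Rightarrow> cd_vec" is
  "\<lambda>n f i. if i < 2 ^ n then f i else 0"
  by (rule finite_subset[of _ "{..<2 ^ _}"]) (auto split: if_splits)

lift_definition cd_snd :: "nat \<Rightarrow> cd_vec \<Rightarrow> cd_vec" is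
  "\<lambda>n f i. if i < 2 ^ n then f (i + 2 ^ n) else 0"
  by (rule finite_subset[of _ "{..<2 ^ _}"]) (auto split: if_splits)

primrec cd_conj :: "nat \<Rightarrow> cd_vec \<Rightarrow> cd_vec" where
  "cd_conj 0 x = x"
| "cd_conj (Suc n) x = cd_pair n (cd_conj n (cd_fst n x)) (- cd_snd n x)"

primrec cd_mult :: "nat \<Rightarrow> cd_vec \<Rightarrow> cd_vec \<Rightarrow> cd_vec" where
  "cd_mult 0 x y = cd_of_real (Poly_Mapping.lookup x 0 * Poly_Mapping.lookup y 0)"
| "cd_mult (Suc n) x y =
    (let a = cd_fst n x; b = cd_snd n x; c = cd_fst n y; d = cd_snd n y in
      cd_pair n
        (cd_mult n a c - cd_mult n (cd_conj n d) b)
        (cd_mult n d a + cd_mult n b (cd_conj n c)))"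

text \<open>
  \<open>(x + x\<^sup>*) / 2\<close> lies in \<open>A\<^sub>0\<close> (see \<open>cd_of_real_Re\<close> below), so reading off its zeroth
  coordinate yields the corresponding real number.
\<close>

definition cd_Re :: "nat \<Rightarrow> cd_vec \<Rightarrow> real" where
  "cd_Re n x = Poly_Mapping.lookup ((1 / 2) *\<^sub>R (x + cd_conj n x)) 0"

definition cd_inner :: "nat \<Rightarrow> cd_vec \<Rightarrow> cd_vec \<Rightarrow> real" where
  "cd_inner n a b = cd_Re n (cd_mult n a (cd_conj n b))"

definition cd_norm :: "nat \<Rightarrow> cd_vec \<Rightarrow> real" where
  "cd_norm n a = sqrt (cd_inner n a a)"

definition cd_M :: "nat \<Rightarrow> cd_vec \<Rightarrow> cd_vec \<Rightarrow> cd_vec" where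
  "cd_M n a x = (1 / (cd_norm n a)\<^sup>2) *\<^sub>R cd_mult n (cd_conj n a) (cd_mult n a x)"

definition cd_Eig :: "nat \<Rightarrow> cd_vec \<Rightarrow> real \<Rightarrow> cd_vec set" where
  "cd_Eig n a \<mu> = {x \<in> cd_alg n. cd_M n a x = \<mu> *\<^sub>R x}"

definition cd_eigenvalue :: "nat \<Rightarrow> cd_vec \<Rightarrow> real \<Rightarrow> bool" where
  "cd_eigenvalue n a \<mu> \<longleftrightarrow> (\<exists>x \<in> cd_alg n. x \<noteq> 0 \<and> cd_M n a x = \<mu> *\<^sub>R x)"

definition diagonalizable_on :: "'v::real_vector set \<Rightarrow> ('v \<Rightarrow> 'v) \<Rightarrow> bool" where
  "diagonalizable_on V f \<longleftrightarrow>
    (\<exists>B. independent B \<and> span B = V \<and> (\<forall>b \<in> B. \<exists>\<mu>::real. f b = \<mu> *\<^sub>R b))"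

subsection \<open>The recursive equations in terms of pairs\<close>

lemma lookup_scaleR [simp]:
  "Poly_Mapping.lookup (r *\<^sub>R (x :: cd_vec)) i = r * Poly_Mapping.lookup x i"
proof -
  have "finite {i. r * Poly_Mapping.lookup x i \<noteq> 0}"
    by (rule finite_subset[OF _ finite_lookup[of x]]) auto
  then show ?thesis by (simp add: scaleR_poly_mapping_def)
qed

lemma cd_alg_iff: "x \<in> cd_alg n \<longleftrightarrow> (\<forall>i \<ge> 2 ^ n. Poly_Mapping.lookup x i = 0)"
  unfolding cd_alg_def by (metis (mono_tags, lifting) in_keys_iff lessThan_iff linorder_not_le mem_Collect_eq subset_eq)

lemma subspace_cd_alg: "subspace (cd_alg n)"
  unfolding subspace_def by (auto simp: cd_alg_iff lookup_add)

lemma cd_alg_0: "cd_alg 0 = range cd_of_real"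
proof -
  have "x = cd_of_real (Poly_Mapping.lookup x 0)" if "x \<in> cd_alg 0" for x
    using that by (intro poly_mapping_eqI)
      (auto simp: cd_alg_iff cd_of_real_def lookup_single when_def)
  moreover have "cd_of_real r \<in> cd_alg 0" for r
    by (simp add: cd_alg_iff cd_of_real_def lookup_single when_def)
  ultimately show ?thesis by blast
qed

lemma cd_alg_mono: "cd_alg n \<subseteq> cd_alg (Suc n)"
  by (auto simp: cd_alg_iff)

lemma cd_pair_in_alg: "a \<in> cd_alg n \<Longrightarrow> b \<in> cd_alg n \<Longrightarrow> cd_pair n a b \<in> cd_alg (Suc n)"
  by (auto simp: cd_alg_iff cd_pair.rep_eq)

lemma cd_fst_in_alg [simp]: "cd_fst n x \<in> cd_alg n"
  and cd_snd_in_alg [simp]: "cd_snd n x \<in> cd_alg n"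
  by (auto simp: cd_alg_iff cd_fst.rep_eq cd_snd.rep_eq)

lemma cd_fst_pair [simp]: "a \<in> cd_alg n \<Longrightarrow> cd_fst n (cd_pair n a b) = a"
  and cd_snd_pair [simp]: "b \<in> cd_alg n \<Longrightarrow> cd_snd n (cd_pair n a b) = b"
  by (auto intro!: poly_mapping_eqI simp: cd_alg_iff cd_pair.rep_eq cd_fst.rep_eq cd_snd.rep_eq)

lemma cd_pair_fst_snd [simp]:
  "x \<in> cd_alg (Suc n) \<Longrightarrow> cd_pair n (cd_fst n x) (cd_snd n x) = x"
  by (intro poly_mapping_eqI)
    (auto simp: cd_alg_iff cd_pair.rep_eq cd_fst.rep_eq cd_snd.rep_eq)

lemma cd_pair_0: "a \<in> cd_alg n \<Longrightarrow> cd_pair n a 0 = a"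
  by (intro poly_mapping_eqI) (auto simp: cd_alg_iff cd_pair.rep_eq)

lemma cd_conj_pair:
  "a \<in> cd_alg n \<Longrightarrow> b \<in> cd_alg n \<Longrightarrow>
    cd_conj (Suc n) (cd_pair n a b) = cd_pair n (cd_conj n a) (- b)"
  by simp

lemma cd_mult_pair:
  assumes "a \<in> cd_alg n" "b \<in> cd_alg n" "c \<in> cd_alg n" "d \<in> cd_alg n"
  shows "cd_mult (Suc n) (cd_pair n a b) (cd_pair n c d) =
    cd_pair n (cd_mult n a c - cd_mult n (cd_conj n d) b)
      (cd_mult n d a + cd_mult n b (cd_conj n c))"
  using assms by (simp add: Let_def)

lemma cd_conj_in_alg: "x \<in> cd_alg n \<Longrightarrow> cd_conj n x \<in> cd_alg n"
  by (induction n arbitrary: x)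
    (auto intro!: cd_pair_in_alg subspace_neg[OF subspace_cd_alg])

lemma cd_mult_in_alg: "cd_mult n x y \<in> cd_alg n"
  by (induction n arbitrary: x y)
    (auto simp: Let_def cd_alg_0
      intro!: cd_pair_in_alg subspace_add[OF subspace_cd_alg] subspace_diff[OF subspace_cd_alg])

lemma cd_M_in_alg: "cd_M n a x \<in> cd_alg n"
  unfolding cd_M_def by (intro subspace_scale[OF subspace_cd_alg] cd_mult_in_alg)

subsection \<open>Linearity\<close>

lemma cd_pair_add: "cd_pair n (a + a') (b + b') = cd_pair n a b + cd_pair n a' b'"
  and cd_pair_scaleR: "cd_pair n (r *\<^sub>R a) (r *\<^sub>R b) = r *\<^sub>R cd_pair n a b"
  and cd_fst_add: "cd_fst n (x + y) = cd_fst n x + cd_fst n y"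
  and cd_fst_scaleR: "cd_fst n (r *\<^sub>R x) = r *\<^sub>R cd_fst n x"
  and cd_snd_add: "cd_snd n (x + y) = cd_snd n x + cd_snd n y"
  and cd_snd_scaleR: "cd_snd n (r *\<^sub>R x) = r *\<^sub>R cd_snd n x"
  by (auto intro!: poly_mapping_eqI simp: lookup_add cd_pair.rep_eq cd_fst.rep_eq cd_snd.rep_eq)

lemma cd_conj_add: "cd_conj n (x + y) = cd_conj n x + cd_conj n y"
  and cd_conj_scaleR: "cd_conj n (r *\<^sub>R x) = r *\<^sub>R cd_conj n x"
  by (induction n arbitrary: x y)
    (simp_all add: cd_fst_add cd_fst_scaleR cd_snd_add cd_snd_scaleR
      flip: cd_pair_add cd_pair_scaleR)

lemma cd_mult_add:
  "cd_mult n (x + x') y = cd_mult n x y + cd_mult n x' y"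
  "cd_mult n x (y + y') = cd_mult n x y + cd_mult n x y'"
  by (induction n arbitrary: x x' y y')
    (simp_all add: Let_def cd_of_real_def lookup_add distrib_left distrib_right single_add
      cd_fst_add cd_snd_add cd_conj_add add_diff_add ac_simps flip: cd_pair_add)

lemma cd_of_real_scaleR: "cd_of_real (r * s) = r *\<^sub>R cd_of_real s"
  by (intro poly_mapping_eqI) (simp add: cd_of_real_def lookup_single when_def)

lemma cd_mult_scaleR:
  "cd_mult n (r *\<^sub>R x) y = r *\<^sub>R cd_mult n x y"
  "cd_mult n x (r *\<^sub>R y) = r *\<^sub>R cd_mult n x y"
proof (induction n arbitrary: x y)
  case 0
  { case 1 show ?case by (simp add: mult.assoc flip: cd_of_real_scaleR) }
  { case 2 show ?case by (simp add: mult.left_commute flip: cd_of_real_scaleR) }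
qed (simp_all add: Let_def cd_fst_scaleR cd_snd_scaleR cd_conj_scaleR
      flip: scaleR_diff_right scaleR_add_right cd_pair_scaleR)

lemma linear_cd_M: "linear (cd_M n a)"
  by (rule linearI) (simp_all add: cd_M_def cd_mult_add cd_mult_scaleR scaleR_add_right)

subsection \<open>Real part and inner product\<close>

lemma cd_pair_of_real: "cd_pair n (cd_of_real r) 0 = cd_of_real r"
  by (intro poly_mapping_eqI) (auto simp: cd_pair.rep_eq cd_of_real_def lookup_single when_def)

lemma cd_of_real_Re:
  assumes "x \<in> cd_alg n"
  shows "cd_of_real (cd_Re n x) = (1 / 2) *\<^sub>R (x + cd_conj n x)"
proof -
  have "x + cd_conj n x \<in> range cd_of_real"
    using assms
  proof (induction n arbitrary: x)
    case 0
    then show ?case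
      using subspace_add[OF subspace_cd_alg, of x 0 x] by (simp flip: cd_alg_0)
  next
    case (Suc n)
    obtain r where r: "cd_fst n x + cd_conj n (cd_fst n x) = cd_of_real r"
      using Suc.IH[of "cd_fst n x"] by auto
    have "x + cd_conj (Suc n) x = cd_pair n (cd_fst n x) (cd_snd n x) + cd_conj (Suc n) x"
      using Suc.prems by simp
    also have "\<dots> = cd_pair n (cd_of_real r) 0"
      by (simp add: r flip: cd_pair_add)
    finally show ?case by (simp add: cd_pair_of_real)
  qed
  then obtain r where r: "x + cd_conj n x = cd_of_real r" by auto
  have "cd_Re n x = (1 / 2) * r"
    unfolding cd_Re_def r by (simp add: cd_of_real_def)
  then show ?thesis by (simp only: r cd_of_real_scaleR)
qed

lemma lookup_cd_conj_0: "Poly_Mapping.lookup (cd_conj n x) 0 = Poly_Mapping.lookup x 0"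
  by (induction n arbitrary: x) (simp_all add: cd_pair.rep_eq cd_fst.rep_eq)

lemma cd_Re_eq_lookup: "cd_Re n x = Poly_Mapping.lookup x 0"
  by (simp add: cd_Re_def lookup_add lookup_cd_conj_0)

lemma cd_conj_conj: "x \<in> cd_alg n \<Longrightarrow> cd_conj n (cd_conj n x) = x"
  by (induction n arbitrary: x)
    (simp_all add: cd_conj_in_alg subspace_neg[OF subspace_cd_alg])

lemma cd_mult_minus:
  "cd_mult n (- x) y = - cd_mult n x y" "cd_mult n x (- y) = - cd_mult n x y"
  using cd_mult_scaleR(1)[of n "-1" x y] cd_mult_scaleR(2)[of n x "-1" y] by simp_all

lemma cd_conj_minus: "cd_conj n (- x) = - cd_conj n x"
  using cd_conj_scaleR[of n "-1"] by simp

lemma sum_lookup_Suc: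
  fixes x y :: cd_vec
  shows "(\<Sum>i<2 ^ Suc n. Poly_Mapping.lookup x i * Poly_Mapping.lookup y i) =
    (\<Sum>i<2 ^ n. Poly_Mapping.lookup (cd_fst n x) i * Poly_Mapping.lookup (cd_fst n y) i) +
    (\<Sum>i<2 ^ n. Poly_Mapping.lookup (cd_snd n x) i * Poly_Mapping.lookup (cd_snd n y) i)"
proof -
  have "(2::nat) ^ Suc n = 2 ^ n + 2 ^ n" by simp
  then show ?thesis
    by (simp only: sum.nat_group[symmetric] lessThan_atLeast0 sum.atLeastLessThan_concat[of 0 "2 ^ n" "2 ^ n + 2 ^ n", symmetric]
        sum.atLeastLessThan_shift_0[of _ "2 ^ n"] cd_fst.rep_eq cd_snd.rep_eq zero_le le_add1)
      (simp add: add.commute)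
qed

lemma lookup_cd_mult_conj_0:
  "Poly_Mapping.lookup (cd_mult n x (cd_conj n y)) 0 =
    (\<Sum>i<2 ^ n. Poly_Mapping.lookup x i * Poly_Mapping.lookup y i)"
  "Poly_Mapping.lookup (cd_mult n (cd_conj n x) y) 0 =
    (\<Sum>i<2 ^ n. Poly_Mapping.lookup x i * Poly_Mapping.lookup y i)"
proof (induction n arbitrary: x y)
  case (Suc n)
  note simps = Let_def cd_pair.rep_eq lookup_minus lookup_add cd_conj_in_alg
    subspace_neg[OF subspace_cd_alg] cd_mult_minus cd_conj_minus sum_lookup_Suc Suc.IH
  { case 1 show ?case by (simp add: simps mult.commute del: power_Suc) }
  { case 2 show ?case by (simp add: simps mult.commute del: power_Suc) }
qed (simp_all add: cd_of_real_def)

lemma cd_inner_eq_sum: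
  "cd_inner n x y = (\<Sum>i<2 ^ n. Poly_Mapping.lookup x i * Poly_Mapping.lookup y i)"
  by (simp add: cd_inner_def cd_Re_eq_lookup lookup_cd_mult_conj_0)

lemma cd_inner_pos:
  assumes "x \<in> cd_alg n" "x \<noteq> 0"
  shows "cd_inner n x x > 0"
proof -
  obtain i where i: "Poly_Mapping.lookup x i \<noteq> 0"
    using assms(2) by (metis lookup_zero poly_mapping_eqI)
  then have "i < 2 ^ n" using assms(1) by (meson cd_alg_iff linorder_not_le)
  then show ?thesis
    unfolding cd_inner_eq_sum by (intro sum_pos2[of _ i]) (use i in \<open>auto simp: zero_less_mult_iff\<close>)
qed

lemma cd_mult_conj_self:
  assumes "a \<in> cd_alg n"
  shows "cd_mult n a (cd_conj n a) = cd_of_real (cd_inner n a a)"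
    and "cd_mult n (cd_conj n a) a = cd_of_real (cd_inner n a a)"
proof -
  have add: "cd_of_real (r + s) = cd_of_real r + cd_of_real s" for r s
    by (simp add: cd_of_real_def single_add)
  have "cd_mult n a (cd_conj n a) = cd_of_real (cd_inner n a a) \<and>
        cd_mult n (cd_conj n a) a = cd_of_real (cd_inner n a a)"
    using assms
  proof (induction n arbitrary: a)
    case 0
    then show ?case by (simp add: cd_inner_eq_sum)
  next
    case (Suc n)
    note IH = Suc.IH[OF cd_fst_in_alg, of a] Suc.IH[OF cd_snd_in_alg, of a]
    have inner: "cd_inner (Suc n) a a =
        cd_inner n (cd_fst n a) (cd_fst n a) + cd_inner n (cd_snd n a) (cd_snd n a)"
      by (simp only: cd_inner_eq_sum sum_lookup_Suc)
    show ?case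
      by (simp add: Let_def cd_conj_in_alg subspace_neg[OF subspace_cd_alg] cd_conj_conj
          cd_mult_minus cd_conj_minus IH inner cd_pair_of_real flip: add)
  qed
  then show "cd_mult n a (cd_conj n a) = cd_of_real (cd_inner n a a)"
    and "cd_mult n (cd_conj n a) a = cd_of_real (cd_inner n a a)" by auto
qed

end

theory Submission
  imports Defs
begin

text \<open>
  With respect to the inner product, left multiplication by \<open>a\<^sup>*\<close> is the adjoint of left
  multiplication by \<open>a\<close>, which is proved together with its mirror image for right
  multiplication by induction over the doubling. Hence \<open>\<langle>M\<^sub>a x, y\<rangle> = \<langle>a x, a y\<rangle> / |a|\<^sup>2\<close>, so
  \<open>M\<^sub>a\<close> is symmetric and positive semidefinite, and the spectral theorem applies.
\<close>

section \<open>The spectral theorem for a symmetric bilinear form\<close>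

text \<open>The polynomial has a minimum at \<open>t = 0\<close>, so its derivative \<open>p\<close>
  there vanishes. This serves as the first-variation argument at the maximum of the Rayleigh
  quotient.\<close>

lemma linear_coeff_zero_if_quadratic_nonneg:
  fixes p q :: real
  assumes "\<And>t. 0 \<le> t * p + t\<^sup>2 * q"
  shows "p = 0"
proof (rule ccontr)
  assume "p \<noteq> 0"
  \<comment> \<open>\<open>r\<close> is positive and exceeds \<open>q\<close>, so at
    \<open>t = - p / r\<close> the linear term \<open>- p^2 / r\<close> outweighs the quadratic
    one.\<close>
  define r where "r = \<bar>q\<bar> + 1"
  have r: "r > 0" "q < r" by (auto simp: r_def)
  have "(- p / r) * p + (- p / r)\<^sup>2 * q = (p / r)\<^sup>2 * (q - r)"
    using r(1) by (simp add: field_simps power2_eq_square)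
  also have "\<dots> < 0"
    using r \<open>p \<noteq> 0\<close> by (simp add: mult_pos_neg)
  finally show False using assms[of "- p / r"] by simp
qed

text \<open>Turns a bilinear form into a polynomial in coordinates, from which continuity is read
  off; the type \<open>'v\<close> itself carries no topology.\<close>

lemma bilinear_sum_scaleR:
  assumes "bilinear ip"
  shows "ip (\<Sum>b\<in>B. c b *\<^sub>R b) (\<Sum>b\<in>B. d b *\<^sub>R b) =
    (\<Sum>b\<in>B. \<Sum>b'\<in>B. c b * d b' * (ip b b' :: real))"
proof -
  have l: "linear (\<lambda>x. ip x y)" "linear (ip y)" for y
    using assms by (auto simp: bilinear_def)
  show ?thesis
    by (simp only: linear_sum[OF l(1)] linear_cmul[OF l(1)])
      (simp add: linear_sum[OF l(2)] linear_cmul[OF l(2)] sum_distrib_left mult.assoc)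
qed

text \<open>A closed subset of a product of compact sets (Tychonoff). Forcing the coordinates
  outside \<open>B\<close> to be zero makes those factors singletons, so an infinite index type does
  no harm.\<close>

lemma compact_unit_coordinate_sphere:
  fixes B :: "'v set"
  assumes "finite B"
  shows "compact {c :: 'v \<Rightarrow> real. (\<forall>v. v \<notin> B \<longrightarrow> c v = 0) \<and> (\<Sum>b\<in>B. (c b)\<^sup>2) = 1}"
    (is "compact ?K")
proof -
  let ?P = "PiE UNIV (\<lambda>v. if v \<in> B then {-1..1::real} else {0})"
  have "compact ?P"
    using compactin_PiE[of "\<lambda>_. euclidean" UNIV "\<lambda>v. if v \<in> B then {-1..1::real} else {0}"]
    by (simp add: euclidean_product_topology)
  moreover have "closed {c :: 'v \<Rightarrow> real. (\<Sum>b\<in>B. (c b)\<^sup>2) = 1}"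
    by (intro closed_Collect_eq continuous_intros continuous_on_product_coordinates)
  moreover have "?K = ?P \<inter> {c. (\<Sum>b\<in>B. (c b)\<^sup>2) = 1}"
  proof (intro equalityI subsetI)
    fix c assume c: "c \<in> ?K"
    have "\<bar>c b\<bar> \<le> 1" if "b \<in> B" for b
      using member_le_sum[of b B "\<lambda>b. (c b)\<^sup>2"] that assms c by (simp add: abs_square_le_1)
    then show "c \<in> ?P \<inter> {c. (\<Sum>b\<in>B. (c b)\<^sup>2) = 1}"
      using c by (auto simp: abs_le_iff minus_le_iff)
  next
    fix c assume c: "c \<in> ?P \<inter> {c. (\<Sum>b\<in>B. (c b)\<^sup>2) = 1}"
    then have "c v \<in> (if v \<in> B then {-1..1} else {0})" for v
      by (blast intro: PiE_mem)
    then have "c v = 0" if "v \<notin> B" for v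
      using that by (metis singletonD)
    then show "c \<in> ?K" using c by simp
  qed
  ultimately show ?thesis by (simp add: compact_Int_closed)
qed

text \<open>The eigenvector is a maximum point of the Rayleigh quotient, which exists because the
  quotient is continuous in the coordinates with respect to a basis.\<close>

lemma symmetric_has_eigenvector:
  fixes f :: "'v::real_vector \<Rightarrow> 'v" and ip :: "'v \<Rightarrow> 'v \<Rightarrow> real"
  assumes B: "finite B" "independent B" "B \<noteq> {}"
    and ip: "bilinear ip" "\<And>x y. ip x y = ip y x"
    and pos: "\<And>x. x \<in> span B \<Longrightarrow> x \<noteq> 0 \<Longrightarrow> ip x x > 0"
    and f: "linear f" "\<And>x. x \<in> span B \<Longrightarrow> f x \<in> span B"
    and sym: "\<And>x y. x \<in> span B \<Longrightarrow> y \<in> span B \<Longrightarrow> ip (f x) y = ip x (f y)"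
  obtains x \<mu> where "x \<in> span B" "x \<noteq> 0" "f x = \<mu> *\<^sub>R x"
proof -
  define K where "K = {c :: 'v \<Rightarrow> real. (\<forall>v. v \<notin> B \<longrightarrow> c v = 0) \<and> (\<Sum>b\<in>B. (c b)\<^sup>2) = 1}"
  define X where "X c = (\<Sum>b\<in>B. c b *\<^sub>R b)" for c :: "'v \<Rightarrow> real"
  define R where "R c = ip (f (X c)) (X c) / ip (X c) (X c)" for c
  note bil = bilinear_ladd[OF ip(1)] bilinear_radd[OF ip(1)] bilinear_lmul[OF ip(1)]
    bilinear_rmul[OF ip(1)] bilinear_lsub[OF ip(1)] bilinear_rsub[OF ip(1)]
  have zero: "ip 0 0 = 0" by (rule bilinear_lzero[OF ip(1)])
  have X_span: "X c \<in> span B" for c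
    unfolding X_def by (intro span_sum span_scale span_base)
  have X_nz: "X c \<noteq> 0" if "c \<in> K" for c
  proof
    assume "X c = 0"
    then have "\<forall>b\<in>B. c b = 0"
      using B(1,2) unfolding X_def by (auto simp: independent_explicit_finite_subsets)
    then show False using that by (simp add: K_def)
  qed
  \<comment> \<open>The numerator is again a bilinear form, so it too is polynomial in the
    coordinates.\<close>
  have "bilinear (\<lambda>x y. ip (f x) y)"
    using ip(1) f(1) linear_compose[OF f(1)] by (auto simp: bilinear_def o_def)
  then have cont_num: "continuous_on K (\<lambda>c. ip (f (X c)) (X c))"
    unfolding X_def by (subst bilinear_sum_scaleR)
      (auto intro!: continuous_intros continuous_on_product_coordinates
        intro: continuous_on_subset[OF continuous_on_product_coordinates])
  have cont_den: "continuous_on K (\<lambda>c. ip (X c) (X c))"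
    unfolding X_def bilinear_sum_scaleR[OF ip(1)]
    by (auto intro!: continuous_intros
        intro: continuous_on_subset[OF continuous_on_product_coordinates])
  have "continuous_on K R"
    unfolding R_def using pos[OF X_span X_nz]
    by (intro continuous_on_divide cont_num cont_den) force
  moreover have "compact K"
    unfolding K_def by (rule compact_unit_coordinate_sphere[OF B(1)])
  moreover obtain b0 where "b0 \<in> B" using B(3) by blast
  then have "(\<lambda>v. if v = b0 then 1 else 0) \<in> K"
    using B(1) by (auto simp: K_def if_distrib[of "\<lambda>x. x\<^sup>2"] cong: if_cong)
  then have "K \<noteq> {}" by blast
  ultimately obtain c0 where c0: "c0 \<in> K" "\<And>c. c \<in> K \<Longrightarrow> R c \<le> R c0"
    using continuous_attains_sup[of K R] by blast
  define x where "x = X c0"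
  \<comment> \<open>Maximality of \<open>R c0\<close> makes the form \<open>ip (h y) z\<close>
    positive semidefinite on \<open>span B\<close>, with \<open>x\<close> as a null vector; the goal
    becomes \<open>h x = 0\<close>.\<close>
  define h where "h y = R c0 *\<^sub>R y - f y" for y
  have x: "x \<in> span B" "x \<noteq> 0" unfolding x_def using X_span X_nz c0 by auto
  have h_nonneg: "ip (h y) y \<ge> 0" if y: "y \<in> span B" for y
  proof (cases "y = 0")
    case True
    then show ?thesis by (simp add: h_def linear_0[OF f(1)] zero)
  next
    case False
    obtain d where d: "y = X d"
      using y B(1) by (auto simp: span_finite X_def)
    define s where "s = sqrt (\<Sum>b\<in>B. (d b)\<^sup>2)"
    have "s \<noteq> 0"
    proof
      assume "s = 0"
      then have "\<forall>b\<in>B. d b = 0" using B(1) by (simp add: s_def sum_nonneg_eq_0_iff)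
      then show False using False d by (simp add: X_def)
    qed
    then have "s > 0" by (simp add: s_def order.strict_iff_order sum_nonneg)
    \<comment> \<open>The coordinates of \<open>y\<close>, normalised to lie in \<open>K\<close>:
      \<open>d\<close> may be arbitrary outside \<open>B\<close>, where \<open>c\<close> must
      vanish. Scaling by \<open>s\<close> only multiplies the quadratic form by
      \<open>s^2\<close>.\<close>
    define c where "c v = (if v \<in> B then d v / s else 0)" for v
    have y_eq: "y = s *\<^sub>R X c"
      using \<open>s \<noteq> 0\<close> by (simp add: d X_def c_def scaleR_sum_right cong: sum.cong)
    have "(\<Sum>b\<in>B. (c b)\<^sup>2) = (\<Sum>b\<in>B. (d b)\<^sup>2) / s\<^sup>2"
      by (simp add: c_def power_divide sum_divide_distrib cong: sum.cong)
    also have "\<dots> = 1"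
      using \<open>s \<noteq> 0\<close> by (simp add: s_def sum_nonneg)
    finally have "c \<in> K" by (simp add: K_def c_def)
    then have "R c \<le> R c0" and "ip (X c) (X c) > 0"
      using c0 pos X_span X_nz by auto
    then have "ip (f (X c)) (X c) \<le> R c0 * ip (X c) (X c)"
      by (simp add: R_def divide_le_eq)
    then have "ip (h (X c)) (X c) \<ge> 0"
      by (simp add: h_def bil)
    moreover have "ip (h y) y = s\<^sup>2 * ip (h (X c)) (X c)"
      by (simp add: y_eq h_def bil linear_cmul[OF f(1)] power2_eq_square algebra_simps)
    ultimately show ?thesis by simp
  qed
  have h_x: "ip (h x) x = 0"
    using pos[OF x] by (simp add: h_def bil) (simp add: R_def x_def)
  have h_orth: "ip (h x) y = 0" if y: "y \<in> span B" for y
  proof -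
    \<comment> \<open>Expand the form at \<open>x + t y\<close>: the constant term vanishes by
      \<open>h_x\<close>, and symmetry of \<open>f\<close> merges the two mixed terms.\<close>
    have "0 \<le> t * (2 * ip (h x) y) + t\<^sup>2 * ip (h y) y" for t
    proof -
      have "0 \<le> ip (h (x + t *\<^sub>R y)) (x + t *\<^sub>R y)"
        by (intro h_nonneg span_add span_scale x y)
      also have "\<dots> = ip (h x) x + t * (ip (h x) y + ip (h y) x) + t\<^sup>2 * ip (h y) y"
        by (simp add: h_def bil linear_add[OF f(1)] linear_cmul[OF f(1)] algebra_simps power2_eq_square)
      also have "ip (h y) x = ip (h x) y"
        using sym[OF x(1) y] ip(2)[of x y] ip(2)[of x "f y"] by (simp add: h_def bil)
      finally show ?thesis by (simp add: h_x)
    qed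
    then show ?thesis using linear_coeff_zero_if_quadratic_nonneg by fastforce
  qed
  have "h x \<in> span B"
    unfolding h_def by (intro span_diff span_scale f x)
  \<comment> \<open>Take \<open>y = h x\<close> in \<open>h_orth\<close>; positive definiteness does
    the rest.\<close>
  then have "h x = 0" using h_orth pos by force
  then show thesis using that[of x "R c0"] x by (simp add: h_def)
qed

text \<open>Induction on the dimension: split off one eigenvector; by symmetry its orthogonal
  complement is invariant, and it has smaller dimension.\<close>

theorem symmetric_diagonalizable_on_span:
  fixes f :: "'v::real_vector \<Rightarrow> 'v" and ip :: "'v \<Rightarrow> 'v \<Rightarrow> real"
  assumes "finite B" "independent B"
    and ip: "bilinear ip" "\<And>x y. ip x y = ip y x"
    and "\<And>x. x \<in> span B \<Longrightarrow> x \<noteq> 0 \<Longrightarrow> ip x x > 0"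
    and f: "linear f"
    and "\<And>x. x \<in> span B \<Longrightarrow> f x \<in> span B"
    and "\<And>x y. x \<in> span B \<Longrightarrow> y \<in> span B \<Longrightarrow> ip (f x) y = ip x (f y)"
  shows "diagonalizable_on (span B) f"
  using assms(1,2,5,7,8)
proof (induction "card B" arbitrary: B rule: less_induct)
  case less
  show ?case
  proof (cases "B = {}")
    case True
    then show ?thesis
      unfolding diagonalizable_on_def by (intro exI[of _ "{}"]) (simp add: independent_empty)
  next
    case False
    note bil = bilinear_ladd[OF ip(1)] bilinear_radd[OF ip(1)] bilinear_lmul[OF ip(1)]
      bilinear_rmul[OF ip(1)] bilinear_lsub[OF ip(1)] bilinear_rsub[OF ip(1)]
      bilinear_rzero[OF ip(1)]
    obtain x \<mu> where x: "x \<in> span B" "x \<noteq> 0" "f x = \<mu> *\<^sub>R x"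
      by (rule symmetric_has_eigenvector[OF less(2,3) False ip less(4) f less(5,6)])
    define W where "W = {y \<in> span B. ip x y = 0}"
    have xx: "ip x x > 0" using less x by blast
    have W: "subspace W"
      unfolding W_def subspace_def by (auto simp: bil intro: span_zero span_add span_scale)
    obtain C where C: "C \<subseteq> W" "independent C" "W \<subseteq> span C"
      by (rule basis_exists)
    have span_C: "span C = W"
      by (intro span_subspace C W)
    \<comment> \<open>Applied twice: to the basis \<open>C\<close> of \<open>W\<close> for the
      dimension count, and later to the eigenbasis of \<open>W\<close>.\<close>
    have indep_insert: "independent (insert x D)" if "independent D" "span D = W" for D
      using that xx by (intro independent_insertI) (auto simp: W_def)
    have "insert x C \<subseteq> span B" using x C by (auto simp: W_def)
    then have fin: "finite (insert x C)" "card (insert x C) \<le> card B"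
      using independent_span_bound[OF less(2) indep_insert[OF C(2) span_C]] by auto
    have "x \<notin> C" using C xx by (auto simp: W_def)
    then have "card C < card B" using fin by simp
    moreover have "f y \<in> W" if "y \<in> W" for y
    proof -
      have "ip x (f y) = ip (f x) y" using that less.prems(5)[of x y] x(1) by (simp add: W_def)
      then show ?thesis using that less.prems(4) by (simp add: W_def x(3) bil)
    qed
    ultimately have "diagonalizable_on (span C) f"
      using less.hyps[of C] less.prems C(2) fin(1) unfolding span_C by (simp add: W_def)
    then obtain D where D: "independent D" "span D = W" "\<forall>b\<in>D. \<exists>\<mu>. f b = \<mu> *\<^sub>R b"
      unfolding diagonalizable_on_def span_C by blast
    have "span (insert x D) = span B"
    proof (rule span_subspace)
      show "insert x D \<subseteq> span B"
        using x D(2) span_superset[of D] by (auto simp: W_def)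
      show "span B \<subseteq> span (insert x D)"
      proof
        fix y assume y: "y \<in> span B"
        \<comment> \<open>The coefficient of the orthogonal projection of \<open>y\<close> onto the
          line through \<open>x\<close>.\<close>
        let ?k = "ip x y / ip x x"
        have "y - ?k *\<^sub>R x \<in> W"
          using x y xx by (simp add: W_def bil span_diff span_scale)
        then show "y \<in> span (insert x D)"
          using D(2) by (auto simp: span_insert)
      qed
    qed simp
    then show ?thesis
      unfolding diagonalizable_on_def
      using indep_insert[OF D(1,2)] D(3) x(3) by (intro exI[of _ "insert x D"]) auto
  qed
qed

section \<open>Adjoints of the multiplication operators\<close>

text \<open>Conjugating the doubling formula reverses each component product by induction. It lets
  the adjoint induction trade left multiplications for right ones.\<close>

lemma cd_conj_mult:
  assumes "x \<in> cd_alg n" "y \<in> cd_alg n"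
  shows "cd_conj n (cd_mult n x y) = cd_mult n (cd_conj n y) (cd_conj n x)"
  using assms
proof (induction n arbitrary: x y)
  case 0
  then show ?case by (simp add: mult.commute)
next
  case (Suc n)
  have diff: "cd_conj n (u - v) = cd_conj n u - cd_conj n v" for u v
    using cd_conj_add[of n u "- v"] by (simp add: cd_conj_minus)
  show ?case
    by (simp add: Let_def cd_conj_in_alg cd_mult_in_alg cd_conj_conj subspace_diff[OF subspace_cd_alg]
        subspace_add[OF subspace_cd_alg] subspace_neg[OF subspace_cd_alg] cd_mult_minus
        cd_conj_minus diff Suc.IH)
qed

lemma cd_inner_Suc:
  "cd_inner (Suc n) x y =
    cd_inner n (cd_fst n x) (cd_fst n y) + cd_inner n (cd_snd n x) (cd_snd n y)"
  by (simp only: cd_inner_eq_sum sum_lookup_Suc)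

lemma cd_inner_commute: "cd_inner n x y = cd_inner n y x"
  by (simp add: cd_inner_eq_sum mult.commute)

lemma bilinear_cd_inner: "bilinear (cd_inner n)"
  unfolding bilinear_def
  by (auto intro!: linearI simp: cd_inner_eq_sum lookup_add algebra_simps sum.distrib sum_distrib_left)

lemma cd_inner_minus: "cd_inner n (- x) y = - cd_inner n x y" "cd_inner n x (- y) = - cd_inner n x y"
  by (simp_all add: bilinear_lneg bilinear_rneg bilinear_cd_inner)

lemma cd_inner_conj:
  "cd_inner n (cd_conj n x) (cd_conj n y) = cd_inner n x y"
proof (induction n arbitrary: x y)
  case (Suc n)
  then show ?case
    by (simp add: cd_inner_Suc cd_inner_minus cd_conj_in_alg subspace_neg[OF subspace_cd_alg])
qed simp

lemma cd_inner_conj_left: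
  assumes "x \<in> cd_alg n"
  shows "cd_inner n (cd_conj n x) y = cd_inner n x (cd_conj n y)"
  using cd_inner_conj[of n "cd_conj n x" y] by (simp add: cd_conj_conj assms)

lemma cd_inner_mult:
  assumes "a \<in> cd_alg n" "x \<in> cd_alg n" "y \<in> cd_alg n"
  shows cd_inner_mult_left: "cd_inner n (cd_mult n a x) y = cd_inner n x (cd_mult n (cd_conj n a) y)"
    and cd_inner_mult_right: "cd_inner n (cd_mult n x a) y = cd_inner n x (cd_mult n y (cd_conj n a))"
  using assms
proof (induction n arbitrary: a x y)
  case 0
  { case 1 then show ?case by (simp add: cd_inner_eq_sum cd_of_real_def) }
  { case 2 then show ?case by (simp add: cd_inner_eq_sum cd_of_real_def) }
next
  case (Suc n)
  note bil = bilinear_ladd[OF bilinear_cd_inner] bilinear_radd[OF bilinear_cd_inner]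
    bilinear_lsub[OF bilinear_cd_inner] bilinear_rsub[OF bilinear_cd_inner] cd_inner_minus
  note alg = cd_conj_in_alg cd_mult_in_alg subspace_diff[OF subspace_cd_alg]
    subspace_add[OF subspace_cd_alg] subspace_neg[OF subspace_cd_alg]
  note simps = Let_def cd_inner_Suc alg bil cd_mult_minus cd_conj_minus cd_conj_conj
  { case (1 a x y)
    let ?p = "cd_fst n a" and ?q = "cd_snd n a" and ?c = "cd_fst n x" and ?d = "cd_snd n x"
      and ?e = "cd_fst n y" and ?f = "cd_snd n y"
    \<comment> \<open>In the two terms with \<open>q\<close> the moving factor is conjugated: take
      the adjoint, shift the conjugation across, and expand, as in \<open>(q^* f)^* = f^* q\<close>.
      These terms interchange the two components.\<close>
    have "cd_inner n (cd_mult n ?q (cd_conj n ?c)) ?f = cd_inner n ?c (cd_mult n (cd_conj n ?f) ?q)"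
      by (simp add: Suc.IH(1) alg cd_inner_conj_left cd_conj_mult cd_conj_conj)
    moreover have "cd_inner n (cd_mult n (cd_conj n ?d) ?q) ?e =
        cd_inner n ?d (cd_mult n ?q (cd_conj n ?e))"
      by (simp add: Suc.IH(2) alg cd_inner_conj_left cd_conj_mult cd_conj_conj)
    moreover have "cd_inner n (cd_mult n ?d ?p) ?f =
        cd_inner n ?d (cd_mult n ?f (cd_conj n ?p))"
      by (simp add: Suc.IH(2) alg)
    ultimately show ?case by (simp add: simps Suc.IH) }
  { case (2 a x y)
    have "cd_inner n (cd_mult n (cd_fst n x) (cd_fst n a)) (cd_fst n y) =
        cd_inner n (cd_fst n x) (cd_mult n (cd_fst n y) (cd_conj n (cd_fst n a)))"
      by (simp add: Suc.IH(2) alg)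
    moreover have "cd_inner n (cd_mult n (cd_snd n x) (cd_conj n (cd_fst n a))) (cd_snd n y) =
        cd_inner n (cd_snd n x) (cd_mult n (cd_snd n y) (cd_fst n a))"
      by (simp add: Suc.IH(2) alg cd_conj_conj)
    \<comment> \<open>The remaining terms \<open>q^* d\<close> and \<open>q c\<close> are left
      multiplications, covered by the other half of the induction hypothesis.\<close>
    ultimately show ?case by (simp add: simps Suc.IH) }
qed

section \<open>Symmetry and spectrum of \<open>cd_M\<close>\<close>

lemma cd_inner_M:
  assumes "a \<in> cd_alg n" "x \<in> cd_alg n" "y \<in> cd_alg n"
  shows "cd_inner n (cd_M n a x) y =
    (1 / (cd_norm n a)\<^sup>2) * cd_inner n (cd_mult n a x) (cd_mult n a y)"
  using assms
  by (simp add: cd_M_def bilinear_lmul[OF bilinear_cd_inner] cd_inner_mult_left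
      cd_conj_in_alg cd_mult_in_alg cd_conj_conj)

lemma cd_M_symmetric:
  assumes "a \<in> cd_alg n" "x \<in> cd_alg n" "y \<in> cd_alg n"
  shows "cd_inner n (cd_M n a x) y = cd_inner n x (cd_M n a y)"
  using assms by (simp add: cd_inner_M cd_inner_commute[of n x] cd_inner_commute[of n "cd_mult n a x"])

text \<open>A finite spanning set, which makes every basis of \<open>cd_alg n\<close> finite, as the
  spectral theorem requires.\<close>

lemma cd_alg_subset_span: "cd_alg n \<subseteq> span ((\<lambda>i. Poly_Mapping.single i 1) ` {..<2 ^ n})"
proof
  fix x assume "x \<in> cd_alg n"
  then have "x = (\<Sum>i<2 ^ n. Poly_Mapping.lookup x i *\<^sub>R Poly_Mapping.single i 1)"
    by (intro poly_mapping_eqI)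
      (auto simp: lookup_sum lookup_single when_def cd_alg_iff if_distrib not_less cong: if_cong)
  also have "\<dots> \<in> span ((\<lambda>i. Poly_Mapping.single i 1) ` {..<2 ^ n})"
    by (intro span_sum span_scale span_base) auto
  finally show "x \<in> span ((\<lambda>i. Poly_Mapping.single i 1) ` {..<2 ^ n})" .
qed

theorem proposition3p9:
  fixes n :: nat and a :: cd_vec
  assumes "a \<in> cd_alg n" and "a \<noteq> 0"
  shows "diagonalizable_on (cd_alg n) (cd_M n a) \<and>
    (\<forall>\<mu>. cd_eigenvalue n a \<mu> \<longrightarrow> \<mu> \<ge> 0) \<and>
    (\<forall>\<mu>1 \<mu>2. cd_eigenvalue n a \<mu>1 \<longrightarrow> cd_eigenvalue n a \<mu>2 \<longrightarrow> \<mu>1 \<noteq> \<mu>2 \<longrightarrow>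
      (\<forall>x \<in> cd_Eig n a \<mu>1. \<forall>y \<in> cd_Eig n a \<mu>2. cd_inner n x y = 0))"
proof (intro conjI allI impI ballI)
  obtain B where B: "B \<subseteq> cd_alg n" "independent B" "cd_alg n \<subseteq> span B"
    by (rule basis_exists)
  have span_B: "span B = cd_alg n"
    by (intro span_subspace B subspace_cd_alg)
  have "finite B"
    using independent_span_bound[OF _ B(2) subset_trans[OF B(1) cd_alg_subset_span]] by simp
  then show "diagonalizable_on (cd_alg n) (cd_M n a)"
    using symmetric_diagonalizable_on_span[OF _ B(2) bilinear_cd_inner cd_inner_commute _ linear_cd_M,
        unfolded span_B, OF _ cd_inner_pos cd_M_in_alg cd_M_symmetric[OF assms(1)]]
    by simp
next
  fix \<mu> assume "cd_eigenvalue n a \<mu>"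
  then obtain x where x: "x \<in> cd_alg n" "x \<noteq> 0" "cd_M n a x = \<mu> *\<^sub>R x"
    unfolding cd_eigenvalue_def by blast
  have "\<mu> * cd_inner n x x = cd_inner n (cd_M n a x) x"
    by (simp add: x bilinear_lmul[OF bilinear_cd_inner])
  \<comment> \<open>By \<open>cd_inner_M\<close> this is \<open>|a x|^2 / |a|^2\<close>, a
    nonnegative multiple of a sum of squares.\<close>
  also have "\<dots> \<ge> 0"
    unfolding cd_inner_M[OF assms(1) x(1) x(1)] by (simp add: cd_inner_eq_sum sum_nonneg)
  finally show "\<mu> \<ge> 0"
    using cd_inner_pos[OF x(1,2)] by (simp add: zero_le_mult_iff)
next
  fix \<mu>1 \<mu>2 x y
  assume ne: "\<mu>1 \<noteq> \<mu>2" and "x \<in> cd_Eig n a \<mu>1" "y \<in> cd_Eig n a \<mu>2"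
  \<comment> \<open>Evaluate \<open>cd_inner n (cd_M n a x) y\<close> on either side of the
    symmetry.\<close>
  then have "\<mu>1 * cd_inner n x y = \<mu>2 * cd_inner n x y"
    using cd_M_symmetric[OF assms(1), of x y]
    by (simp add: cd_Eig_def bilinear_lmul[OF bilinear_cd_inner] bilinear_rmul[OF bilinear_cd_inner])
  then show "cd_inner n x y = 0" using ne by simp
qed

end
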